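(* Let $n$ be a positive integer. Every circled composition of $n$ is Wilf equivalent (as a circled composition) to a circled composition of $n$ of one of the following forms, where $(1^\circ)^{j}$ denotes $j$ consecutive circled parts $1^\circ$ and all $a_i$ are uncircled parts: (1) $(1^\circ)^n$; (2) $(1^\circ)^{k_0}\ a_1\ a_2\ \cdots\ a_k\ (1^\circ)^{k_1}\ a_{k+1}\ (1^\circ)^{k_2}$ with $k_0 \geq k_2$, $a_1 \geq a_2 \geq \cdots \geq a_k \geq a_{k+1}$, and $a_1,\dots,a_{k+1},k_0,k_2 \neq 2$; (3) $(1^\circ)^{k_0}\ a_1\ a_2\ \cdots\ a_k\ (1^\circ)^{k_2}$ with $k_0 \geq k_2$, $k_0,k_2 \neq 2$, $a_1 \geq a_2 \geq \cdots \geq a_k$, and, if $k \geq 2$, $a_1,\dots,a_k \neq 2$.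
   Context: A circled composition of $n$ is a pair $(a,C)$ where $a=(a_1,\dots,a_k)$ is a composition of $n$ (a sequence of positive integers summing to $n$) and $C \subseteq \{1,\dots,k\}$ is such that $1 \in C$, $k \in C$, and $a_i = 1$ for all $i \in C$. It is written as the sequence of parts, with the parts indexed by $C$ marked as circled (written $1^\circ$) and the others uncircled. A circled composition $X$ dominates a circled composition $Y$ if $Y$ can be obtained from $X$ as follows: select a subsequence of the parts of $X$; replace any uncircled number $k$ in it by some number in $\{1,\dots,k\}$; then, if the first or last term is an uncircled number $k$, replace it by $k$ circled parts $1^\circ$. Two circled compositions $X,Y$ are Wilf equivalent if for every $n \geq 1$ the number of circled compositions of $n$ dominating $X$ equals the number dominating $Y$. *)

theory Defs
  imports "HOL-Library.Sublist"
begin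

text \<open>A circled composition \<open>(a, C)\<close> is represented by the sequence of its parts, the parts
  indexed by \<open>C\<close> being marked. Circled parts are always equal to 1, so they carry no number.\<close>

datatype part = Circled | Uncircled nat

fun part_size :: "part \<Rightarrow> nat" where
  "part_size Circled = 1"
| "part_size (Uncircled k) = k"

definition circled_composition :: "nat \<Rightarrow> part list \<Rightarrow> bool" where
  "circled_composition n X \<longleftrightarrow>
     (\<forall>p \<in> set X. part_size p \<ge> 1) \<and> sum_list (map part_size X) = n \<and>
     X \<noteq> [] \<and> hd X = Circled \<and> last X = Circled"

text \<open>\<open>part_reduces p q\<close>: the selected part \<open>p\<close> may be replaced by \<open>q\<close>.\<close>

fun part_reduces :: "part \<Rightarrow> part \<Rightarrow> bool" where
  "part_reduces Circled q \<longleftrightarrow> q = Circled"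
| "part_reduces (Uncircled k) q \<longleftrightarrow> (\<exists>j \<in> {1..k}. q = Uncircled j)"

fun circle_part :: "part \<Rightarrow> part list" where
  "circle_part Circled = [Circled]"
| "circle_part (Uncircled k) = replicate k Circled"

text \<open>The first and the last term are both circled; in a sequence of length one these are the
  same term, which is then replaced only once.\<close>

definition circle_ends :: "part list \<Rightarrow> part list" where
  "circle_ends S =
     (if length S \<ge> 2 then circle_part (hd S) @ butlast (tl S) @ circle_part (last S)
      else concat (map circle_part S))"

definition dominates :: "part list \<Rightarrow> part list \<Rightarrow> bool" where
  "dominates X Y \<longleftrightarrow>
     (\<exists>S T. subseq S X \<and> list_all2 part_reduces S T \<and> Y = circle_ends T)"

definition wilf_equivalent :: "part list \<Rightarrow> part list \<Rightarrow> bool" where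
  "wilf_equivalent X Y \<longleftrightarrow>
     (\<forall>n\<ge>1. card {Z. circled_composition n Z \<and> dominates Z X} =
             card {Z. circled_composition n Z \<and> dominates Z Y})"

end

(* Write a circled composition with some uncircled part as (1o)^k0 m (1o)^k2, where m begins and
   ends with uncircled parts. Matching the prefix greedily from the left, then the letters of m
   one by one, and the suffix greedily from the right cuts every dominating composition in a
   unique way into a minimal word reaching k0, a first-hit word for each letter p of m, an
   arbitrary word, and a reversed minimal word reaching k2. So the generating function of the
   dominating compositions is F(k0) * (PROD p in m. D(p)) * W * F(k2); it is invariant under
   permuting the letters of m (as long as the two ends stay uncircled) and under exchanging
   k0 and k2. Moreover D(2) = D(1) D(1o) and F(2) = F(1) D(1), so every uncircled 2 can be
   traded for 1 and 1o, and a prefix or suffix (1o)^2 for 1o and an uncircled 1 in m. *)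
theory Submission
  imports Defs "HOL-Computational_Algebra.Formal_Power_Series" "HOL-Library.Multiset"
begin

section \<open>Arithmetic of generating functions of unambiguous languages\<close>

section \<open>Generating functions of sets of words\<close>

definition weight :: "part list \<Rightarrow> nat" where
  "weight w = sum_list (map part_size w)"

text \<open>The datatype admits an uncircled part of size 0. Excluding it bounds the length of a
  word by its weight, so that each weight is attained by finitely many words.\<close>

definition proper :: "part set" where
  "proper = {p. part_size p \<ge> 1}"

text \<open>Integer coefficients make subtraction available. Since \<open>card\<close> is 0 on
  infinite sets, the sum and product rules are restricted to languages inside
  \<open>lists proper\<close>.\<close>

definition gf :: "part list set \<Rightarrow> int fps" where
  "gf L = Abs_fps (\<lambda>n. int (card {w \<in> L. weight w = n}))"

definition conc :: "part list set \<Rightarrow> part list set \<Rightarrow> part list set" where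
  "conc A B = (\<lambda>(u, v). u @ v) ` (A \<times> B)"

definition single :: "part set \<Rightarrow> part list set" where
  "single A = (\<lambda>q. [q]) ` A"

text \<open>This is the notion of a prefix code: the first factor of a product can be read off from
  the word, whatever language follows.\<close>

definition prefix_free :: "part list set \<Rightarrow> bool" where
  "prefix_free A \<longleftrightarrow> (\<forall>u\<in>A. \<forall>v\<in>A. prefix u v \<longrightarrow> u = v)"

lemma concI: "u \<in> A \<Longrightarrow> v \<in> B \<Longrightarrow> u @ v \<in> conc A B"
  by (auto simp: conc_def)

lemma weight_simps [simp]:
  "weight [] = 0" "weight (p # w) = part_size p + weight w"
  "weight (u @ v) = weight u + weight v" "weight (rev w) = weight w"
  by (simp_all add: weight_def rev_map [symmetric] sum_list_rev)

lemma gf_nth: "fps_nth (gf L) n = int (card {w \<in> L. weight w = n})"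
  by (simp add: gf_def)

lemma length_le_weight: "w \<in> lists proper \<Longrightarrow> length w \<le> weight w"
  by (induction w) (auto simp: proper_def)

lemma part_size_le_weight: "p \<in> set w \<Longrightarrow> part_size p \<le> weight w"
  by (induction w) auto

lemma finite_weight:
  assumes "A \<subseteq> lists proper"
  shows "finite {w \<in> A. weight w = n}"
proof (rule finite_subset)
  show "finite {w. set w \<subseteq> insert Circled (Uncircled ` {..n}) \<and> length w \<le> n}"
    by (rule finite_lists_length_le) auto
  show "{w \<in> A. weight w = n} \<subseteq> \<dots>"
  proof safe
    fix w p assume w: "w \<in> A" "n = weight w" and p: "p \<in> set w" "p \<notin> Uncircled ` {..weight w}"
    then show "p = Circled"
      using part_size_le_weight[OF p(1)] by (cases p) auto
  next
    fix w assume "w \<in> A"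
    then show "length w \<le> weight w"
      using length_le_weight assms by auto
  qed
qed

text \<open>Unambiguous factorization turns the words of weight \<open>n\<close> into a disjoint
  union of pairs of weights \<open>i\<close> and \<open>n - i\<close>, which is the Cauchy
  product.\<close>

lemma gf_conc:
  assumes A: "A \<subseteq> lists proper" and B: "B \<subseteq> lists proper"
    and inj: "inj_on (\<lambda>(u, v). u @ v) (A \<times> B)"
  shows "gf (conc A B) = gf A * gf B"
proof (rule fps_ext)
  fix n
  let ?S = "\<lambda>i. {u \<in> A. weight u = i} \<times> {v \<in> B. weight v = n - i}"
  have "{w \<in> conc A B. weight w = n} = (\<lambda>(u, v). u @ v) ` (\<Union>i\<in>{0..n}. ?S i)"
    by (force simp: conc_def image_iff)
  then have "card {w \<in> conc A B. weight w = n} = card (\<Union>i\<in>{0..n}. ?S i)"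
    by (auto intro!: card_image inj_on_subset[OF inj])
  also have "\<dots> = (\<Sum>i\<in>{0..n}. card (?S i))"
    by (rule card_UN_disjoint) (auto intro!: finite_cartesian_product finite_weight A B)
  finally show "fps_nth (gf (conc A B)) n = fps_nth (gf A * gf B) n"
    by (simp add: gf_nth fps_mult_nth card_cartesian_product)
qed

lemma inj_conc_prefix_free:
  "prefix_free A \<Longrightarrow> inj_on (\<lambda>(u, v). u @ v) (A \<times> B)"
proof (rule inj_onI, clarify)
  fix u v u' v' assume A: "prefix_free A" "u \<in> A" "u' \<in> A" and eq: "u @ v = u' @ v'"
  from eq have "prefix u u' \<or> prefix u' u"
    by (metis prefixI prefix_same_cases)
  with A have "u = u'"
    by (auto simp: prefix_free_def)
  with eq show "u = u' \<and> v = v'"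
    by simp
qed

text \<open>Reversal turns a cut from the right into a cut from the left; this handles the circled
  suffix of a pattern.\<close>

lemma inj_conc_suffix_free:
  assumes "prefix_free B"
  shows "inj_on (\<lambda>(u, v). u @ v) (A \<times> rev ` B)"
proof (rule inj_onI, clarify)
  fix u v u' v' assume *: "v \<in> B" "v' \<in> B" "u @ rev v = u' @ rev v'"
  then have "v @ rev u = v' @ rev u'"
    by (metis rev_append rev_rev_ident)
  with * show "u = u' \<and> rev v = rev v'"
    using inj_onD[OF inj_conc_prefix_free[OF assms, of UNIV], of "(v, rev u)" "(v', rev u')"]
    by simp
qed

lemma gf_rev: "gf (rev ` A) = gf A"
proof (rule fps_ext)
  fix n
  have "{w \<in> rev ` A. weight w = n} = rev ` {w \<in> A. weight w = n}"
    by auto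
  then show "fps_nth (gf (rev ` A)) n = fps_nth (gf A) n"
    by (simp add: gf_nth card_image)
qed

lemma gf_Un:
  assumes "A \<subseteq> lists proper" "B \<subseteq> lists proper" "A \<inter> B = {}"
  shows "gf (A \<union> B) = gf A + gf B"
proof (rule fps_ext)
  fix n
  have "{w \<in> A \<union> B. weight w = n} = {w \<in> A. weight w = n} \<union> {w \<in> B. weight w = n}"
    by auto
  then show "fps_nth (gf (A \<union> B)) n = fps_nth (gf A + gf B) n"
    using assms by (simp add: gf_nth card_Un_disjoint finite_weight disjoint_iff)
qed

lemma gf_single_Un:
  assumes "A \<subseteq> proper" "B \<subseteq> proper" "A \<inter> B = {}"
  shows "gf (single (A \<union> B)) = gf (single A) + gf (single B)"
  unfolding single_def image_Un by (rule gf_Un) (use assms in auto)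

lemma gf_singleton: "gf {w} = fps_X ^ weight w"
proof (rule fps_ext)
  fix n
  have "{v \<in> {w}. weight v = n} = (if n = weight w then {w} else {})"
    by auto
  then show "fps_nth (gf {w}) n = fps_nth (fps_X ^ weight w) n"
    by (simp add: gf_nth)
qed

lemma prefix_free_single: "prefix_free (single A)"
  by (auto simp: prefix_free_def single_def)

text \<open>A nonempty word splits off its first letter in exactly one way. This gives the geometric
  series, stated without division.\<close>

lemma gf_lists:
  assumes "A \<subseteq> proper"
  shows "gf (lists A) * (1 - gf (single A)) = 1"
proof -
  have "w \<in> lists A \<longleftrightarrow> w = [] \<or> w \<in> conc (single A) (lists A)" for w
    by (cases w) (auto simp: conc_def single_def image_iff)
  then have "lists A = {[]} \<union> conc (single A) (lists A)"
    by blast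
  then have "gf (lists A) = gf ({[]} \<union> conc (single A) (lists A))"
    by simp
  also have "\<dots> = 1 + gf (conc (single A) (lists A))"
    using assms by (subst gf_Un) (auto simp: conc_def single_def gf_singleton subset_iff)
  also have "gf (conc (single A) (lists A)) = gf (single A) * gf (lists A)"
    using assms
    by (intro gf_conc inj_conc_prefix_free prefix_free_single) (auto simp: single_def)
  finally show ?thesis
    by (simp add: algebra_simps)
qed

section \<open>Minimal words with a given property\<close>

section \<open>First hits\<close>

definition first_hits :: "(part list \<Rightarrow> bool) \<Rightarrow> part list set" where
  "first_hits R = {w \<in> lists proper. R w \<and> (\<forall>u. strict_prefix u w \<longrightarrow> \<not> R u)}"

abbreviation letter_hits :: "(part \<Rightarrow> bool) \<Rightarrow> part list set" where
  "letter_hits Q \<equiv> first_hits (\<lambda>w. \<exists>q\<in>set w. Q q)"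

lemma first_hits_proper: "first_hits R \<subseteq> lists proper"
  by (auto simp: first_hits_def)

lemma prefix_free_first_hits: "prefix_free (first_hits R)"
  by (auto simp: first_hits_def prefix_free_def strict_prefix_def)

lemma first_hits_split:
  assumes "w \<in> lists proper" "R w"
  obtains u v where "w = u @ v" "u \<in> first_hits R" "v \<in> lists proper"
proof -
  let ?k = "LEAST k. R (take k w)"
  have R: "R (take ?k w)"
    by (rule LeastI[of _ "length w"]) (use assms in simp)
  have minimal: "\<not> R u" if u: "strict_prefix u (take ?k w)" for u
  proof
    assume "R u"
    from u obtain v where v: "take ?k w = u @ v" "v \<noteq> []"
      by (auto simp: strict_prefix_def prefix_def)
    then have "w = u @ v @ drop ?k w"
      by (metis append_assoc append_take_drop_id)
    then have "take (length u) w = u"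
      by (metis append_eq_conv_conj)
    with \<open>R u\<close> have "?k \<le> length u"
      by (metis Least_le)
    moreover have "length u < length (take ?k w)"
      using v by simp
    ultimately show False
      by simp
  qed
  have proper: "take ?k w \<in> lists proper" "drop ?k w \<in> lists proper"
    using assms(1) by (metis append_in_lists_conv append_take_drop_id)+
  show ?thesis
  proof
    show "w = take ?k w @ drop ?k w"
      by (rule append_take_drop_id [symmetric])
    show "take ?k w \<in> first_hits R"
      unfolding first_hits_def using R minimal proper(1) by blast
    show "drop ?k w \<in> lists proper"
      by (rule proper(2))
  qed
qed

text \<open>By minimality, the only letter satisfying \<open>Q\<close> is the last one.\<close>

lemma letter_hits_eq:
  "letter_hits Q = conc (lists {p \<in> proper. \<not> Q p}) (single {p \<in> proper. Q p})" (is "?L = ?R")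
proof
  show "?L \<subseteq> ?R"
  proof
    fix w assume w: "w \<in> ?L"
    then obtain u q where uq: "w = u @ [q]"
      by (cases w rule: rev_cases) (auto simp: first_hits_def)
    then have "strict_prefix u w"
      by (simp add: strict_prefix_def)
    with w have "\<forall>p\<in>set u. \<not> Q p"
      by (auto simp: first_hits_def)
    with w uq show "w \<in> ?R"
      by (auto simp: first_hits_def conc_def single_def image_iff)
  qed
  show "?R \<subseteq> ?L"
    by (auto simp: first_hits_def conc_def single_def strict_prefix_def prefix_snoc)
       (auto dest: set_mono_prefix)
qed

lemma gf_letter_hits:
  "gf (letter_hits Q) * (1 - gf (single {p \<in> proper. \<not> Q p})) = gf (single {p \<in> proper. Q p})"
proof -
  have "gf (letter_hits Q) = gf (lists {p \<in> proper. \<not> Q p}) * gf (single {p \<in> proper. Q p})"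
    unfolding letter_hits_eq
    by (rule gf_conc) (auto simp: single_def inj_on_def)
  then show ?thesis
    using gf_lists[of "{p \<in> proper. \<not> Q p}"] by (simp add: mult.commute mult.left_commute)
qed

section \<open>Explicit series for the letters circled 1, uncircled 1 and uncircled 2\<close>

definition uncircled_gf :: "int fps" where
  "uncircled_gf = gf (single (proper - {Circled}))"

lemma uncircled_gf_eq: "uncircled_gf * (1 - fps_X) = fps_X"
proof -
  have nth: "fps_nth uncircled_gf n = (if n = 0 then 0 else 1)" for n
  proof -
    have "{w \<in> single (proper - {Circled}). weight w = n} =
        (if n = 0 then {} else {[Uncircled n]})"
      by (auto simp: single_def proper_def) (metis part.exhaust part_size.simps(2))
    then show ?thesis
      by (simp add: uncircled_gf_def gf_nth)
  qed
  show ?thesis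
    by (rule fps_ext) (simp add: nth right_diff_distrib)
qed

lemma gf_single_proper: "gf (single proper) = fps_X + uncircled_gf"
proof -
  have "gf (single ({Circled} \<union> (proper - {Circled}))) = fps_X + uncircled_gf"
    by (subst gf_single_Un)
       (auto simp: proper_def uncircled_gf_def single_def gf_singleton)
  also have "{Circled} \<union> (proper - {Circled}) = proper"
    by (auto simp: proper_def)
  finally show ?thesis .
qed

text \<open>Only the letters that fail \<open>Q\<close> have to be counted: those that satisfy it
  make up the rest of the alphabet, whose series is \<open>fps_X + uncircled_gf\<close>.\<close>

lemma gf_letter_hits_eq:
  assumes "gf (single {p \<in> proper. \<not> Q p}) = s"
  shows "gf (letter_hits Q) * (1 - s) = fps_X + uncircled_gf - s"
proof -
  have "gf (single ({p \<in> proper. \<not> Q p} \<union> {p \<in> proper. Q p})) = s + gf (single {p \<in> proper. Q p})"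
    using assms by (subst gf_single_Un) auto
  also have "{p \<in> proper. \<not> Q p} \<union> {p \<in> proper. Q p} = proper"
    by auto
  finally show ?thesis
    using gf_letter_hits[of Q] assms by (simp add: gf_single_proper)
qed

definition hit_gf :: "part \<Rightarrow> int fps" where
  "hit_gf p = gf (letter_hits (\<lambda>q. part_reduces q p))"

lemma hit_gf_Circled: "hit_gf Circled * (1 - uncircled_gf) = fps_X"
proof -
  have "{p \<in> proper. \<not> part_reduces p Circled} = proper - {Circled}"
    by (auto elim: part_reduces.elims)
  then show ?thesis
    unfolding hit_gf_def by (subst gf_letter_hits_eq) (auto simp: uncircled_gf_def)
qed

lemma hit_gf_1: "hit_gf (Uncircled 1) * (1 - fps_X) = uncircled_gf"
proof -
  have "p \<in> proper \<and> \<not> part_reduces p (Uncircled 1) \<longleftrightarrow> p = Circled" for p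
    by (cases p) (auto simp: proper_def)
  then have "{p \<in> proper. \<not> part_reduces p (Uncircled 1)} = {Circled}"
    by blast
  then show ?thesis
    unfolding hit_gf_def by (subst gf_letter_hits_eq) (auto simp: single_def gf_singleton)
qed

lemma hit_gf_2: "hit_gf (Uncircled 2) * (1 - 2 * fps_X) = uncircled_gf - fps_X"
proof -
  have "p \<in> proper \<and> \<not> part_reduces p (Uncircled 2) \<longleftrightarrow> p = Circled \<or> p = Uncircled 1" for p
    by (cases p) (auto simp: proper_def)
  then have "{p \<in> proper. \<not> part_reduces p (Uncircled 2)} = {Circled} \<union> {Uncircled 1}"
    by blast
  moreover have "gf (single ({Circled} \<union> {Uncircled 1})) = 2 * fps_X"
    by (subst gf_single_Un) (auto simp: single_def gf_singleton proper_def)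
  ultimately show ?thesis
    unfolding hit_gf_def by (subst gf_letter_hits_eq) auto
qed

lemma one_minus_fps_nonzero:
  fixes f :: "int fps"
  assumes "fps_nth f 0 = 0"
  shows "1 - f \<noteq> 0"
proof
  assume "1 - f = 0"
  then have "fps_nth (1 - f) 0 = 0" by simp
  with assms show False by simp
qed

text \<open>With s = x/(1-x), both sides are x^2/((1-x)(1-2x)). This identity allows an uncircled 2
  to be traded for an uncircled 1 and a circled 1.\<close>

lemma hit_gf_split_2: "hit_gf (Uncircled 1) * hit_gf Circled = hit_gf (Uncircled 2)"
proof -
  let ?x = "fps_X :: int fps" and ?s = uncircled_gf
  \<comment> \<open>The denominators of the three hit series, with one more factor
    \<open>1 - ?x\<close> to clear the denominator of \<open>?s\<close>. Each factor has constant
    term 1, so \<open>?c\<close> can be cancelled.\<close>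
  let ?c = "(1 - ?s) * (1 - ?x) * (1 - 2 * ?x) * (1 - ?x)"
  have "fps_nth ?s 0 = 0"
  proof -
    have "fps_nth (?s * (1 - ?x)) 0 = 0" by (simp only: uncircled_gf_eq) simp
    then show ?thesis by simp
  qed
  then have nz: "?c \<noteq> 0"
    using one_minus_fps_nonzero[of ?s] one_minus_fps_nonzero[of ?x]
      one_minus_fps_nonzero[of "2 * ?x"] by simp
  have "(hit_gf (Uncircled 1) * hit_gf Circled) * ?c =
      (hit_gf (Uncircled 1) * (1 - ?x)) * (hit_gf Circled * (1 - ?s)) * (1 - 2 * ?x) * (1 - ?x)"
    by (simp only: ac_simps)
  also have "\<dots> = ?x * (?s * (1 - ?x)) * (1 - 2 * ?x)"
    unfolding hit_gf_1 hit_gf_Circled by (simp only: ac_simps)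
  \<comment> \<open>Both sides equal x^2 (1-2x) once \<open>?s * (1 - ?x)\<close> is replaced by
    \<open>?x\<close>.\<close>
  also have "\<dots> = (?s * (1 - ?x) - ?x * (1 - ?x)) * ((1 - ?x) - ?s * (1 - ?x))"
    unfolding uncircled_gf_eq by (simp add: algebra_simps)
  also have "\<dots> = (?s - ?x) * (1 - ?s) * (1 - ?x) * (1 - ?x)"
    by (simp add: algebra_simps)
  also have "\<dots> = hit_gf (Uncircled 2) * ?c"
    unfolding hit_gf_2 [symmetric] by (simp only: ac_simps)
  finally show ?thesis
    using nz by simp
qed

section \<open>Greedy matching of the three pieces of a pattern\<close>

section \<open>Matching the middle and the ends\<close>

definition contains :: "part list \<Rightarrow> part list \<Rightarrow> bool" where
  "contains m w \<longleftrightarrow> (\<exists>S. subseq S w \<and> list_all2 part_reduces S m)"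

lemma contains_append1: "contains m w \<Longrightarrow> contains m (u @ w)"
  unfolding contains_def by (meson list_emb_append2)

lemma contains_append2: "contains m w \<Longrightarrow> contains m (w @ u)"
  unfolding contains_def by (meson subseq_rev_drop_many)

lemma contains_append_iff:
  "contains (m @ m') w \<longleftrightarrow> (\<exists>u v. w = u @ v \<and> contains m u \<and> contains m' v)"
proof
  assume "contains (m @ m') w"
  then obtain S1 S2 where "subseq (S1 @ S2) w"
    "list_all2 part_reduces S1 m" "list_all2 part_reduces S2 m'"
    by (auto simp: contains_def list_all2_append2)
  then show "\<exists>u v. w = u @ v \<and> contains m u \<and> contains m' v"
    unfolding contains_def by (meson list_emb_appendD)
next
  assume "\<exists>u v. w = u @ v \<and> contains m u \<and> contains m' v"
  then show "contains (m @ m') w"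
    unfolding contains_def by (auto intro: list_emb_append_mono list_all2_appendI)
qed

lemma subseq_rev: "subseq xs ys \<Longrightarrow> subseq (rev xs) (rev ys)"
  by (induction rule: list_emb.induct) (auto intro: list_emb_append_mono)

lemma contains_rev_iff: "contains (rev m) (rev w) \<longleftrightarrow> contains m w"
proof -
  have "contains (rev m) (rev w)" if "contains m w" for m w
    using that unfolding contains_def by (metis list_all2_rev subseq_rev)
  then show ?thesis by (metis rev_rev_ident)
qed

lemma contains_single_iff: "contains [p] w \<longleftrightarrow> (\<exists>q\<in>set w. part_reduces q p)"
proof
  assume "\<exists>q\<in>set w. part_reduces q p"
  then obtain q where "q \<in> set w" "part_reduces q p" ..
  then show "contains [p] w"
    unfolding contains_def by (intro exI[of _ "[q]"]) (auto simp: subseq_singleton_left)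
qed (auto simp: contains_def list_all2_Cons2 subseq_singleton_left)

definition container_words :: "part list \<Rightarrow> part list set" where
  "container_words m = {w \<in> lists proper. contains m w}"

text \<open>The word is cut right after the first letter that reduces to \<open>p\<close>. Letters
  left over from any other match of \<open>p\<close> move to the remainder, where they do no
  harm.\<close>

lemma gf_container_words_Cons:
  "gf (container_words (p # m)) = hit_gf p * gf (container_words m)"
proof -
  let ?H = "letter_hits (\<lambda>q. part_reduces q p)"
  have "container_words (p # m) = conc ?H (container_words m)"
  proof
    show "container_words (p # m) \<subseteq> conc ?H (container_words m)"
    proof
      fix w assume "w \<in> container_words (p # m)"
      then have "w \<in> lists proper" "contains ([p] @ m) w"
        by (simp_all add: container_words_def)
      then obtain u v where w: "w = u @ v" "u \<in> lists proper" "v \<in> lists proper"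
        and uv: "contains [p] u" "contains m v"
        unfolding contains_append_iff by (metis append_in_lists_conv)
      from uv(1) have "\<exists>q\<in>set u. part_reduces q p"
        by (simp add: contains_single_iff)
      with w(2) obtain u1 u2 where "u = u1 @ u2" "u1 \<in> ?H" "u2 \<in> lists proper"
        by (rule first_hits_split)
      with w uv contains_append1[of m v u2] show "w \<in> conc ?H (container_words m)"
        by (auto simp: conc_def container_words_def image_iff intro!: bexI[of _ u1])
    qed
    show "conc ?H (container_words m) \<subseteq> container_words (p # m)"
      using contains_append_iff[of "[p]" m]
      by (auto simp: conc_def container_words_def first_hits_def contains_single_iff)
  qed
  then show ?thesis
    unfolding hit_gf_def
    by (auto intro!: gf_conc inj_conc_prefix_free prefix_free_first_hits
        simp: first_hits_proper container_words_def)
       (use first_hits_proper in blast)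
qed

lemma gf_container_words:
  "gf (container_words m) = prod_list (map hit_gf m) * gf (lists proper)"
proof (induction m)
  case Nil
  have "contains [] w" for w by (simp add: contains_def)
  then show ?case by (simp add: container_words_def)
next
  case (Cons p m)
  then show ?case by (simp add: gf_container_words_Cons mult.assoc)
qed

text \<open>\<open>reaches k w\<close>: the circled prefix \<open>(1\<degree>)\<^sup>k\<close> of a pattern can be matched inside \<open>w\<close>. Since the
  first term of the selection may be an uncircled part that is circled afterwards, this is
  weaker than \<open>w\<close> having \<open>k\<close> circled parts.\<close>

definition reaches :: "nat \<Rightarrow> part list \<Rightarrow> bool" where
  "reaches k w \<longleftrightarrow>
     (\<exists>t T. contains (t # T) w \<and> circle_part t @ T = replicate k Circled)"

text \<open>The condition on the head reflects that a dominating circled composition begins with a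
  circled part; its last part is treated in the same way after reversal.\<close>

definition end_words :: "nat \<Rightarrow> part list set" where
  "end_words k = {w \<in> first_hits (reaches k). hd w = Circled}"

lemma reaches_nonempty: "reaches k w \<Longrightarrow> w \<noteq> []"
  by (auto simp: reaches_def contains_def list_all2_Cons2)

lemma end_words_proper: "end_words k \<subseteq> lists proper"
  using first_hits_proper by (auto simp: end_words_def)

lemma prefix_free_end_words: "prefix_free (end_words k)"
  using prefix_free_first_hits[of "reaches k"] by (auto simp: end_words_def prefix_free_def)

lemma reaches_1: "reaches 1 [Circled]"
  unfolding reaches_def
  by (rule exI[of _ Circled], rule exI[of _ "[]"]) (auto simp: contains_single_iff)

lemma end_words_1: "end_words 1 = {[Circled]}"
proof -
  have "w = [Circled]" if "w \<in> end_words 1" for w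
  proof -
    from that reaches_nonempty obtain v where "w = Circled # v"
      by (cases w) (auto simp: end_words_def first_hits_def)
    with that reaches_1 show ?thesis
      by (cases v) (auto simp: end_words_def first_hits_def strict_prefix_def)
  qed
  moreover have "[Circled] \<in> end_words 1"
    using reaches_1 reaches_nonempty
    by (auto simp: end_words_def first_hits_def proper_def strict_prefix_def prefix_Cons)
  ultimately show ?thesis by blast
qed

text \<open>After the initial circled part, a second circled part can be selected in
  \<open>v\<close>, or an uncircled part of size at least 2 in \<open>v\<close> alone supplies both
  circles. If \<open>v\<close> has only uncircled 1s, neither is possible.\<close>

lemma reaches_2_iff:
  assumes "v \<in> lists proper"
  shows "reaches 2 (Circled # v) \<longleftrightarrow> (\<exists>q\<in>set v. q \<noteq> Uncircled 1)"
proof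
  assume "reaches 2 (Circled # v)"
  then obtain t T s S where tT: "circle_part t @ T = [Circled, Circled]"
    and S: "subseq (s # S) (Circled # v)" "part_reduces s t" "list_all2 part_reduces S T"
    by (auto simp: reaches_def contains_def list_all2_Cons2 numeral_2_eq_2)
  from S(1) have Sv: "subseq S v"
    by (metis subseq_Cons2_iff subseq_Cons')
  show "\<exists>q\<in>set v. q \<noteq> Uncircled 1"
  \<comment> \<open>If \<open>T\<close> is empty, \<open>t\<close> must be an uncircled 2, so
    \<open>s\<close> has size at least 2. Otherwise a circled part is matched behind
    \<open>s\<close>, hence inside \<open>v\<close>.\<close>
  proof (cases "T = []")
    case True
    with tT S(2) have "s \<noteq> Circled" "s \<noteq> Uncircled 1"
      by (cases t; auto simp: numeral_2_eq_2)+
    moreover have "s \<in> set (Circled # v)"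
      using list_emb_set[OF S(1), of s] by auto
    ultimately show ?thesis by auto
  next
    case False
    with tT have "last T = Circled" "T \<noteq> []"
      by (metis last.simps last_appendR list.discI, simp)
    then have "Circled \<in> set T" by (metis last_in_set)
    then obtain q where "q \<in> set S" "part_reduces q Circled"
      using S(3) by (metis in_set_conv_nth list_all2_conv_all_nth)
    moreover from this(1) Sv have "q \<in> set v"
      by (auto dest: list_emb_set)
    ultimately show ?thesis
      by (intro bexI[of _ q]) auto
  qed
next
  assume "\<exists>q\<in>set v. q \<noteq> Uncircled 1"
  then obtain q where q: "q \<in> set v" "q \<noteq> Uncircled 1" by blast
  show "reaches 2 (Circled # v)"
  proof (cases q)
    case Circled
    with q have "subseq [Circled, Circled] (Circled # v)"
      by (simp add: subseq_singleton_left)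
    then have "contains [Circled, Circled] (Circled # v)"
      unfolding contains_def by (intro exI[of _ "[Circled, Circled]"]) auto
    then show ?thesis
      unfolding reaches_def
      by (intro exI[of _ Circled] exI[of _ "[Circled]"]) (auto simp: numeral_2_eq_2)
  next
    case (Uncircled j)
    with q assms have "j \<ge> 2"
      by (auto simp: proper_def)
    with Uncircled q have "contains [Uncircled 2] (Circled # v)"
      by (auto simp: contains_single_iff intro!: bexI[of _ q])
    then show ?thesis
      unfolding reaches_def by (intro exI[of _ "Uncircled 2"] exI[of _ "[]"]) auto
  qed
qed

text \<open>After the initial circled part one waits for a letter other than uncircled 1. Waiting
  for an uncircled letter, as in \<open>hit_gf (Uncircled 1)\<close>, also excludes exactly one
  letter of size 1, so the two series agree.\<close>

lemma gf_end_words_2: "gf (end_words 2) = gf (end_words 1) * hit_gf (Uncircled 1)"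
proof -
  let ?H = "letter_hits (\<lambda>q. q \<noteq> Uncircled 1)"
  have not_reaches_Nil: "\<not> reaches 2 []"
    using reaches_nonempty by blast
  have iff: "Circled # v \<in> end_words 2 \<longleftrightarrow> v \<in> ?H" for v
  proof (cases "v \<in> lists proper")
    case True
    then have sub: "u \<in> lists proper" if "strict_prefix u v" for u
      using that by (auto simp: strict_prefix_def prefix_def)
    \<comment> \<open>The empty word is the one strict prefix that does not start with the circled
      part; it never reaches 2.\<close>
    have "(\<forall>u. strict_prefix u (Circled # v) \<longrightarrow> \<not> reaches 2 u) \<longleftrightarrow>
        (\<forall>u. strict_prefix u v \<longrightarrow> \<not> reaches 2 (Circled # u))"
      using not_reaches_Nil by (auto simp: strict_prefix_def prefix_Cons)
    with True sub show ?thesis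
      by (auto simp: end_words_def first_hits_def reaches_2_iff proper_def)
  next
    case False
    then show ?thesis by (auto simp: end_words_def first_hits_def)
  qed
  have "end_words 2 = conc (end_words 1) ?H"
  proof -
    have "w \<in> end_words 2 \<longleftrightarrow> (\<exists>v. w = Circled # v \<and> v \<in> ?H)" for w
    proof (cases w)
      case Nil
      with not_reaches_Nil show ?thesis by (auto simp: end_words_def first_hits_def)
    next
      case (Cons p v)
      with iff[of v] show ?thesis by (cases "p = Circled") (auto simp: end_words_def)
    qed
    moreover have "w \<in> conc {[Circled]} ?H \<longleftrightarrow> (\<exists>v. w = Circled # v \<and> v \<in> ?H)" for w
      by (simp add: conc_def image_iff Bex_def conj_commute del: One_nat_def)
    ultimately show ?thesis
      unfolding end_words_1 set_eq_iff by blast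
  qed
  then have "gf (end_words 2) = gf (end_words 1) * gf ?H"
    by (simp only:)
       (intro gf_conc inj_conc_prefix_free prefix_free_end_words end_words_proper first_hits_proper)
  moreover have "gf ?H = hit_gf (Uncircled 1)"
  proof -
    have "{p \<in> proper. \<not> p \<noteq> Uncircled 1} = {Uncircled 1}"
      by (auto simp: proper_def)
    then have "gf ?H * (1 - fps_X) = hit_gf (Uncircled 1) * (1 - fps_X)"
      unfolding hit_gf_1 by (subst gf_letter_hits_eq) (auto simp: single_def gf_singleton)
    then show ?thesis
      using one_minus_fps_nonzero[of fps_X] by simp
  qed
  ultimately show ?thesis by simp
qed

section \<open>Factorization of the language of dominating compositions\<close>

section \<open>The generating function of a circled composition\<close>

definition dominators :: "part list \<Rightarrow> part list set" where
  "dominators Y =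
     {Z \<in> lists proper. Z \<noteq> [] \<and> hd Z = Circled \<and> last Z = Circled \<and> dominates Z Y}"

lemma circled_composition_iff:
  "circled_composition n Z \<longleftrightarrow>
     Z \<in> lists proper \<and> weight Z = n \<and> Z \<noteq> [] \<and> hd Z = Circled \<and> last Z = Circled"
  by (auto simp: circled_composition_def proper_def weight_def)

lemma wilf_equivalentI:
  assumes "gf (dominators X) = gf (dominators Y)"
  shows "wilf_equivalent X Y"
proof -
  have eq: "{Z. circled_composition n Z \<and> dominates Z W} = {Z \<in> dominators W. weight Z = n}" for n W
    by (auto simp: circled_composition_iff dominators_def)
  have "fps_nth (gf (dominators X)) n = fps_nth (gf (dominators Y)) n" for n
    using assms by simp
  then show ?thesis
    by (simp add: wilf_equivalent_def eq gf_nth)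
qed

lemma circle_part_eq: "circle_part p = replicate (part_size p) Circled"
  by (cases p) auto

text \<open>The first letter of \<open>m\<close> differs from \<open>c\<close>, so the leading run
  of \<open>c\<close> on the right has length exactly \<open>k\<close>.\<close>

lemma replicate_append_eqD:
  assumes "replicate i c @ A = replicate k c @ m @ B" "m \<noteq> []" "hd m \<noteq> c"
  shows "i \<le> k \<and> A = replicate (k - i) c @ m @ B"
  using assms
proof (induction i arbitrary: k)
  case (Suc i)
  then show ?case by (cases k; cases m) auto
qed auto

lemma circle_ends_append:
  assumes "m \<noteq> []"
  shows "circle_ends ((t # T) @ m @ rev (t' # T')) =
    (circle_part t @ T) @ m @ rev (circle_part t' @ T')"
proof -
  have "rev (circle_part t') = circle_part t'"
    by (simp add: circle_part_eq)
  then show ?thesis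
    using assms by (simp add: circle_ends_def butlast_append)
qed

text \<open>The uncircled ends of \<open>m\<close> separate the two outer runs of circles. Hence
  circling the first term affects only the prefix, circling the last term only the suffix, and the
  three pieces are matched independently.\<close>

lemma dominates_iff:
  assumes m: "m \<noteq> []" "hd m \<noteq> Circled" "last m \<noteq> Circled"
  shows "dominates X (replicate k0 Circled @ m @ replicate k2 Circled) \<longleftrightarrow>
    (\<exists>u v w. X = u @ v @ rev w \<and> reaches k0 u \<and> contains m v \<and> reaches k2 w)" (is "?L \<longleftrightarrow> ?R")
proof
  assume ?L
  then obtain T where T: "contains T X"
    "replicate k0 Circled @ m @ replicate k2 Circled = circle_ends T"
    by (auto simp: dominates_def contains_def)
  \<comment> \<open>A single term would produce only circles, leaving no room for the uncircled head
    of \<open>m\<close>.\<close>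
  have "length T \<ge> 2"
  proof (rule ccontr)
    assume "\<not> length T \<ge> 2"
    then have "set (circle_ends T) \<subseteq> {Circled}"
      by (auto simp: circle_ends_def circle_part_eq)
    moreover have "hd m \<in> set (circle_ends T)"
      using m(1) T(2) by (metis Un_iff hd_in_set set_append)
    ultimately show False using m(2) by auto
  qed
  then obtain t T' t' where T': "T = t # T' @ [t']"
    by (cases T; cases "tl T" rule: rev_cases) auto
  let ?i = "part_size t" and ?j = "part_size t'"
  from T(2) T' have eq: "replicate ?i Circled @ T' @ replicate ?j Circled =
      replicate k0 Circled @ m @ replicate k2 Circled"
    by (simp add: circle_ends_def circle_part_eq)
  from replicate_append_eqD[OF eq m(1,2)] have i: "?i \<le> k0"
    and eq2: "T' @ replicate ?j Circled = replicate (k0 - ?i) Circled @ m @ replicate k2 Circled"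
    by auto
  \<comment> \<open>The right end is treated by cancelling on the left in the reversed
    equation.\<close>
  from arg_cong[OF eq2, of rev]
  have eq3: "replicate ?j Circled @ rev T' =
      replicate k2 Circled @ rev m @ replicate (k0 - ?i) Circled"
    by simp
  have "rev m \<noteq> []" "hd (rev m) \<noteq> Circled"
    using m by (simp_all add: hd_rev)
  from replicate_append_eqD[OF eq3 this] have j: "?j \<le> k2"
    and "rev T' = replicate (k2 - ?j) Circled @ rev m @ replicate (k0 - ?i) Circled"
    by auto
  from arg_cong[OF this(2), of rev]
  have "T' = replicate (k0 - ?i) Circled @ m @ replicate (k2 - ?j) Circled"
    by simp
  with T' have "T = (t # replicate (k0 - ?i) Circled) @ m @ rev (t' # replicate (k2 - ?j) Circled)"
    by simp
  with T(1) obtain u v x where X: "X = u @ v @ x"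
    and u: "contains (t # replicate (k0 - ?i) Circled) u" and v: "contains m v"
    and x: "contains (rev (t' # replicate (k2 - ?j) Circled)) x"
    by (simp only: contains_append_iff) blast
  from u i have "reaches k0 u"
    unfolding reaches_def circle_part_eq by (metis le_add_diff_inverse replicate_add)
  moreover from x j have "reaches k2 (rev x)"
    unfolding reaches_def circle_part_eq
    by (metis le_add_diff_inverse replicate_add contains_rev_iff rev_rev_ident)
  ultimately show ?R
    using X v by (metis rev_rev_ident)
next
  assume ?R
  then obtain u v w t T t' T' where X: "X = u @ v @ rev w" and v: "contains m v"
    and u: "contains (t # T) u" "circle_part t @ T = replicate k0 Circled"
    and w: "contains (t' # T') w" "circle_part t' @ T' = replicate k2 Circled"
    unfolding reaches_def by blast
  have "contains ((t # T) @ m @ rev (t' # T')) X"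
    unfolding contains_append_iff X using u(1) v w(1) contains_rev_iff by blast
  moreover have "circle_ends ((t # T) @ m @ rev (t' # T')) =
      replicate k0 Circled @ m @ replicate k2 Circled"
    by (simp only: circle_ends_append[OF m(1)] u(2) w(2) rev_replicate)
  ultimately show ?L
    unfolding dominates_def contains_def by metis
qed

text \<open>The left factor is a prefix code and the right factor a reversed one, so the cuts are
  unique. The right-hand side ignores the order of the letters of \<open>m\<close> and is symmetric
  in \<open>k0\<close> and \<open>k2\<close>.\<close>

lemma gf_dominators:
  assumes m: "m \<noteq> []" "hd m \<noteq> Circled" "last m \<noteq> Circled"
  shows "gf (dominators (replicate k0 Circled @ m @ replicate k2 Circled)) =
    gf (end_words k0) * prod_list (map hit_gf m) * gf (end_words k2) * gf (lists proper)"
proof -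
  let ?Y = "replicate k0 Circled @ m @ replicate k2 Circled"
  let ?M = "conc (container_words m) (rev ` end_words k2)"
  have M: "?M \<subseteq> lists proper"
    using end_words_proper by (fastforce simp: conc_def container_words_def)
  have "dominators ?Y = conc (end_words k0) ?M"
  proof
    show "dominators ?Y \<subseteq> conc (end_words k0) ?M"
    proof
      fix Z assume Z: "Z \<in> dominators ?Y"
      then obtain u v w where uvw: "Z = u @ v @ rev w" "reaches k0 u" "contains m v" "reaches k2 w"
        unfolding dominators_def using dominates_iff[OF m] by auto
      with Z have proper: "u \<in> lists proper" "v \<in> lists proper" "w \<in> lists proper"
        by (auto simp: dominators_def)
      obtain u1 u2 where u: "u = u1 @ u2" "u1 \<in> first_hits (reaches k0)" "u2 \<in> lists proper"
        using first_hits_split[of u "reaches k0"] proper(1) uvw(2) by blast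
      obtain w1 w2 where w: "w = w1 @ w2" "w1 \<in> first_hits (reaches k2)" "w2 \<in> lists proper"
        using first_hits_split[of w "reaches k2"] proper(3) uvw(4) by blast
      have ne: "u1 \<noteq> []" "w1 \<noteq> []"
        using u(2) w(2) reaches_nonempty by (auto simp: first_hits_def)
      have eq: "Z = u1 @ (u2 @ v @ rev w2) @ rev w1"
        by (simp add: uvw(1) u(1) w(1))
      with ne have "hd Z = hd u1" "last Z = hd w1"
        by (simp_all add: last_rev)
      with Z u(2) w(2) have "u1 \<in> end_words k0" "w1 \<in> end_words k2"
        by (auto simp: dominators_def end_words_def)
      \<comment> \<open>The surplus of both greedy cuts is absorbed by the middle.\<close>
      moreover have "u2 @ v @ rev w2 \<in> container_words m"
        using u(3) w(3) proper(2) uvw(3)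
        by (auto simp: container_words_def contains_append1 contains_append2)
      ultimately show "Z \<in> conc (end_words k0) ?M"
        unfolding eq by (intro concI imageI)
    qed
    show "conc (end_words k0) ?M \<subseteq> dominators ?Y"
    proof
      fix Z assume Z: "Z \<in> conc (end_words k0) ?M"
      then obtain u v w where eq: "Z = u @ v @ rev w"
        and uvw: "u \<in> end_words k0" "v \<in> container_words m" "w \<in> end_words k2"
        by (auto simp: conc_def)
      then have "reaches k0 u" "contains m v" "reaches k2 w" "hd u = Circled" "hd w = Circled"
        by (auto simp: end_words_def first_hits_def container_words_def)
      moreover from this have "u \<noteq> []" "w \<noteq> []"
        using reaches_nonempty by auto
      moreover have "Z \<in> lists proper"
        using Z M end_words_proper by (fastforce simp: conc_def)
      ultimately show "Z \<in> dominators ?Y"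
        unfolding dominators_def using dominates_iff[OF m] eq by (auto simp: last_rev)
    qed
  qed
  then have "gf (dominators ?Y) = gf (conc (end_words k0) ?M)"
    by simp
  also have "\<dots> = gf (end_words k0) * gf ?M"
    using M by (intro gf_conc inj_conc_prefix_free prefix_free_end_words end_words_proper)
  also have "gf ?M = gf (container_words m) * gf (rev ` end_words k2)"
    using end_words_proper
    by (intro gf_conc inj_conc_suffix_free prefix_free_end_words)
       (fastforce simp: container_words_def)+
  finally show ?thesis
    by (simp add: gf_rev gf_container_words ac_simps)
qed

section \<open>Trading letters to reach the normal form\<close>

section \<open>Normal forms\<close>

text \<open>\<open>L\<close> holds the uncircled 1 split off from an end of length 2; it is to be
  moved into the middle.\<close>

lemma normalize_end:
  assumes "k \<ge> 1"
  obtains k' L where "k' \<ge> 1" "k' \<noteq> 2" "k = k' + weight L" "L = [] \<or> L = [Uncircled 1]"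
    "gf (end_words k) = gf (end_words k') * prod_list (map hit_gf L)"
proof (cases "k = 2")
  case True
  then show ?thesis
    by (intro that[of 1 "[Uncircled 1]"]) (simp_all add: gf_end_words_2 del: One_nat_def)
next
  case False
  with assms show ?thesis by (intro that[of k "[]"]) simp_all
qed

text \<open>\<open>c\<close> counts the circled letters, including those split off from uncircled
  2s. The number of uncircled letters is recorded because two of them are later needed as the ends
  of the middle.\<close>

lemma normalize_middle_unsorted:
  assumes "m \<in> lists proper"
  shows "\<exists>us c. 2 \<notin> set us \<and> 0 \<notin> set us \<and> weight m = sum_list us + c \<and>
    length us = length (filter (\<lambda>p. p \<noteq> Circled) m) \<and>
    prod_list (map hit_gf m) = prod_list (map (\<lambda>a. hit_gf (Uncircled a)) us) * hit_gf Circled ^ c"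
  using assms
proof (induction m)
  case Nil
  show ?case by (intro exI[of _ "[]"] exI[of _ 0]) auto
next
  case (Cons p m)
  then obtain us c where us: "2 \<notin> set us" "0 \<notin> set us" "weight m = sum_list us + c"
    "length us = length (filter (\<lambda>p. p \<noteq> Circled) m)"
    "prod_list (map hit_gf m) = prod_list (map (\<lambda>a. hit_gf (Uncircled a)) us) * hit_gf Circled ^ c"
    by blast
  show ?case
  proof (cases p)
    case Circled
    with us show ?thesis
      by (intro exI[of _ us] exI[of _ "Suc c"]) (auto simp: mult.left_commute)
  next
    case (Uncircled a)
    show ?thesis
    proof (cases "a = 2")
      case True
      let ?us = "1 # us"
      have "prod_list (map hit_gf (p # m)) = hit_gf (Uncircled 2) * prod_list (map hit_gf m)"
        by (simp add: Uncircled True)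
      also have "\<dots> =
          prod_list (map (\<lambda>a. hit_gf (Uncircled a)) ?us) * hit_gf Circled ^ Suc c"
        unfolding us(5) hit_gf_split_2 [symmetric] list.map prod_list.Cons power_Suc
        by (simp only: ac_simps)
      finally show ?thesis
        using us(1-4) Uncircled True by (intro exI[of _ ?us] exI[of _ "Suc c"]) simp
    next
      case False
      with Uncircled us Cons.hyps show ?thesis
        by (intro exI[of _ "a # us"] exI[of _ c]) (auto simp: mult.assoc proper_def)
    qed
  qed
qed

lemma normalize_middle:
  assumes "m \<in> lists proper"
  obtains us c where "sorted_wrt (\<ge>) us" "2 \<notin> set us" "0 \<notin> set us" "weight m = sum_list us + c"
    "length us = length (filter (\<lambda>p. p \<noteq> Circled) m)"
    "prod_list (map hit_gf m) = prod_list (map (\<lambda>a. hit_gf (Uncircled a)) us) * hit_gf Circled ^ c"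
proof -
  obtain us c where us: "2 \<notin> set us" "0 \<notin> set us" "weight m = sum_list us + c"
    "length us = length (filter (\<lambda>p. p \<noteq> Circled) m)"
    "prod_list (map hit_gf m) = prod_list (map (\<lambda>a. hit_gf (Uncircled a)) us) * hit_gf Circled ^ c"
    using normalize_middle_unsorted[OF assms] by blast
  let ?us = "rev (sort us)"
  have "sum_list ?us = sum_list us"
    by (metis mset_rev mset_sort sum_mset_sum_list)
  moreover have "prod_list (map f ?us) = prod_list (map f us)" for f :: "nat \<Rightarrow> int fps"
  proof -
    have "mset (map f ?us) = mset (map f us)"
      by simp
    then show ?thesis
      by (simp only: prod_mset_prod_list [symmetric])
  qed
  moreover have "sorted_wrt (\<ge>) ?us"
    by (simp add: sorted_wrt_rev)
  ultimately show ?thesis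
    using us by (intro that[of ?us c]) simp_all
qed

lemma strip_replicate:
  obtains k Z where "X = replicate k c @ Z" "Z = [] \<or> hd Z \<noteq> c"
proof -
  have "\<exists>k Z. X = replicate k c @ Z \<and> (Z = [] \<or> hd Z \<noteq> c)"
  proof (induction X)
    case Nil
    show ?case by auto
  next
    case (Cons x X)
    then obtain k Z where X: "X = replicate k c @ Z" "Z = [] \<or> hd Z \<noteq> c" by blast
    show ?case
    proof (cases "x = c")
      case True
      with X show ?thesis by (intro exI[of _ "Suc k"] exI[of _ Z]) auto
    next
      case False
      then show ?thesis by (intro exI[of _ 0] exI[of _ "x # X"]) auto
    qed
  qed
  with that show thesis by blast
qed

lemma weight_replicate_Circled [simp]: "weight (replicate c Circled) = c"
  by (induction c) auto

lemma weight_map_Uncircled [simp]: "weight (map Uncircled us) = sum_list us"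
  by (induction us) auto

lemma circled_composition_cases:
  assumes "circled_composition n X"
  obtains "X = replicate n Circled"
  | k0 m k2 where "X = replicate k0 Circled @ m @ replicate k2 Circled" "k0 \<ge> 1" "k2 \<ge> 1"
    "m \<noteq> []" "hd m \<noteq> Circled" "last m \<noteq> Circled"
proof -
  obtain k0 Z where X: "X = replicate k0 Circled @ Z" "Z = [] \<or> hd Z \<noteq> Circled"
    by (rule strip_replicate)
  obtain k2 M where Z: "rev Z = replicate k2 Circled @ M" "M = [] \<or> hd M \<noteq> Circled"
    by (rule strip_replicate)
  have X_ends: "X \<noteq> []" "hd X = Circled" "last X = Circled" "weight X = n"
    using assms by (auto simp: circled_composition_iff)
  show thesis
  proof (cases "Z = []")
    case True
    with X X_ends that(1) show thesis by simp
  next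
    case False
    have Z_eq: "Z = rev M @ replicate k2 Circled"
      using arg_cong[OF Z(1), of rev] by simp
    \<comment> \<open>Otherwise \<open>Z\<close> would be a nonempty run of circles, although its
      head is uncircled.\<close>
    have "M \<noteq> []"
      using False X(2) Z_eq by (cases k2) auto
    with X(2) False Z Z_eq have m: "rev M \<noteq> []" "hd (rev M) \<noteq> Circled" "last (rev M) \<noteq> Circled"
      by (auto simp: last_rev)
    moreover have "k0 \<ge> 1"
      using X X_ends False by (cases k0) auto
    moreover have "k2 \<ge> 1"
      using X X_ends Z_eq m by (cases k2) auto
    ultimately show thesis
      using that(2) X(1) Z_eq by blast
  qed
qed

text \<open>The sequence in the theorem is indexed from 1, lists from 0. The range stops short of
  \<open>length xs\<close>, so the last entry is left for the isolated part.\<close>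

lemma map_nth_pred: "map (\<lambda>i. f (xs ! (i - 1))) [1..<length xs] = map f (butlast xs)"
  by (rule nth_equalityI) (auto simp: nth_butlast)

theorem theorem4p25:
  fixes n :: nat and X :: "part list"
  assumes "n \<ge> 1" and "circled_composition n X"
  shows "\<exists>Y. circled_composition n Y \<and> wilf_equivalent X Y \<and>
    (Y = replicate n Circled \<or>
     (\<exists>(k::nat) (a :: nat \<Rightarrow> nat) (k0::nat) (k1::nat) (k2::nat).
        k \<ge> 1 \<and> k0 \<ge> 1 \<and> k2 \<ge> 1 \<and>
        Y = replicate k0 Circled @ map (\<lambda>i. Uncircled (a i)) [1..<k + 1]
              @ replicate k1 Circled @ [Uncircled (a (k + 1))] @ replicate k2 Circled \<and>
        k0 \<ge> k2 \<and>
        (\<forall>i \<in> {1..k}. a i \<ge> a (i + 1)) \<and>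
        (\<forall>i \<in> {1..k + 1}. a i \<noteq> 2) \<and> k0 \<noteq> 2 \<and> k2 \<noteq> 2) \<or>
     (\<exists>(k::nat) (a :: nat \<Rightarrow> nat) (k0::nat) (k2::nat).
        k0 \<ge> 1 \<and> k2 \<ge> 1 \<and>
        Y = replicate k0 Circled @ map (\<lambda>i. Uncircled (a i)) [1..<k + 1]
              @ replicate k2 Circled \<and>
        k0 \<ge> k2 \<and> k0 \<noteq> 2 \<and> k2 \<noteq> 2 \<and>
        (\<forall>i \<in> {1..<k}. a i \<ge> a (i + 1)) \<and>
        (k \<ge> 2 \<longrightarrow> (\<forall>i \<in> {1..k}. a i \<noteq> 2))))"
proof (rule circled_composition_cases[OF assms(2)])
  assume "X = replicate n Circled"
  with assms(2) show ?thesis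
    by (intro exI[of _ X] conjI wilf_equivalentI disjI1) auto
next
  fix j0 m j2
  assume X: "X = replicate j0 Circled @ m @ replicate j2 Circled" and j: "j0 \<ge> 1" "j2 \<ge> 1"
    and m: "m \<noteq> []" "hd m \<noteq> Circled" "last m \<noteq> Circled"
  obtain i0 L0 where L0: "i0 \<ge> 1" "i0 \<noteq> 2" "j0 = i0 + weight L0" "L0 = [] \<or> L0 = [Uncircled 1]"
    "gf (end_words j0) = gf (end_words i0) * prod_list (map hit_gf L0)"
    using normalize_end[OF j(1)] .
  obtain i2 L2 where L2: "i2 \<ge> 1" "i2 \<noteq> 2" "j2 = i2 + weight L2" "L2 = [] \<or> L2 = [Uncircled 1]"
    "gf (end_words j2) = gf (end_words i2) * prod_list (map hit_gf L2)"
    using normalize_end[OF j(2)] .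
  let ?m = "L0 @ m @ L2"
  \<comment> \<open>The two end factors commute, so the longer run may be put on the left.\<close>
  define k0 where "k0 = max i0 i2"
  define k2 where "k2 = min i0 i2"
  have k: "k0 \<ge> 1" "k2 \<ge> 1" "k0 \<ge> k2" "k0 \<noteq> 2" "k2 \<noteq> 2" "k0 + k2 = i0 + i2"
    using L0 L2 by (auto simp: k0_def k2_def max_def min_def)
  have k_gf: "gf (end_words k0) * gf (end_words k2) = gf (end_words i0) * gf (end_words i2)"
    by (simp add: k0_def k2_def max_def min_def mult.commute)
  have m_proper: "?m \<in> lists proper" and n: "n = k0 + weight ?m + k2"
    using assms(2) X L0 L2 k(6) by (auto simp: circled_composition_iff proper_def)
  \<comment> \<open>Any rearrangement or trade in the middle is allowed as long as weight, product
    of series and uncircled ends are kept.\<close>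
  have equiv: "circled_composition n (replicate k0 Circled @ m' @ replicate k2 Circled) \<and>
      wilf_equivalent X (replicate k0 Circled @ m' @ replicate k2 Circled)"
    if m': "m' \<noteq> []" "hd m' \<noteq> Circled" "last m' \<noteq> Circled" "m' \<in> lists proper"
      "weight m' = weight ?m" "prod_list (map hit_gf m') = prod_list (map hit_gf ?m)" for m'
  proof
    show "circled_composition n (replicate k0 Circled @ m' @ replicate k2 Circled)"
      using m' n k by (auto simp: circled_composition_iff proper_def hd_append)
    have "gf (dominators X) =
        gf (end_words i0) * gf (end_words i2) * prod_list (map hit_gf ?m) * gf (lists proper)"
      by (simp add: X gf_dominators[OF m] L0(5) L2(5) ac_simps)
    also have "\<dots> = gf (dominators (replicate k0 Circled @ m' @ replicate k2 Circled))"
      unfolding gf_dominators[OF m'(1-3)] m'(6) k_gf [symmetric] by (simp only: ac_simps)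
    finally show "wilf_equivalent X (replicate k0 Circled @ m' @ replicate k2 Circled)"
      by (rule wilf_equivalentI)
  qed
  show ?thesis
  proof (cases "L0 = [] \<and> L2 = [] \<and> length m = 1")
    \<comment> \<open>A lone uncircled part stays as it is, even if it is 2: this is the third form
      with \<open>k = 1\<close>, where the value 2 is permitted.\<close>
    case True
    then obtain a where a: "m = [Uncircled a]"
      using m(2) by (cases m) (auto, metis part.exhaust)
    let ?Y = "replicate k0 Circled @ [Uncircled a] @ replicate k2 Circled"
    have "circled_composition n ?Y \<and> wilf_equivalent X ?Y"
      using True a m_proper by (intro equiv) auto
    moreover have "?Y = replicate k0 Circled @ map (\<lambda>i. Uncircled a) [1..<1 + 1] @ replicate k2 Circled"
      by simp
    ultimately show ?thesis
      using k by - (rule exI[of _ ?Y], intro conjI, simp, simp, intro disjI2, rule exI[of _ 1],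
        rule exI[of _ "\<lambda>_. a"], rule exI[of _ k0], rule exI[of _ k2], auto)
  next
    case False
    obtain us c where us: "sorted_wrt (\<ge>) us" "2 \<notin> set us" "0 \<notin> set us"
      "weight ?m = sum_list us + c" "length us = length (filter (\<lambda>p. p \<noteq> Circled) ?m)"
      "prod_list (map hit_gf ?m) =
        prod_list (map (\<lambda>a. hit_gf (Uncircled a)) us) * hit_gf Circled ^ c"
      using normalize_middle[OF m_proper] .
    \<comment> \<open>Either \<open>m\<close> has two distinct uncircled ends, or it is one
      uncircled letter and \<open>L0\<close> or \<open>L2\<close> supplies another.\<close>
    have len: "length us \<ge> 2"
    proof (cases "length m = 1")
      case True
      with False L0(4) L2(4) m(2) show ?thesis
        unfolding us(5) by (cases m) auto
    next
      case False
      with m(1) obtain p m1 q where "m = p # m1 @ [q]"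
        by (cases m; cases "tl m" rule: rev_cases) auto
      with m show ?thesis
        unfolding us(5) by auto
    qed
    obtain b l where bl: "us = b @ [l]"
      using len by (cases us rule: rev_cases) auto
    have b: "b \<noteq> []"
      using len bl by auto
    \<comment> \<open>All circled letters go just before the smallest uncircled part
      \<open>l\<close>. As \<open>b\<close> is nonempty, both ends stay uncircled; \<open>c\<close>
      may be 0, which is still the second form.\<close>
    define m' where "m' = map Uncircled b @ replicate c Circled @ [Uncircled l]"
    let ?Y = "replicate k0 Circled @ m' @ replicate k2 Circled"
    have "circled_composition n ?Y \<and> wilf_equivalent X ?Y"
    proof (rule equiv)
      show "hd m' \<noteq> Circled"
        using b by (simp add: m'_def hd_append hd_map)
      show "m' \<in> lists proper"
        using us(3) by (auto simp: m'_def bl proper_def Suc_le_eq intro!: gr0I)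
      show "prod_list (map hit_gf m') = prod_list (map hit_gf ?m)"
        unfolding us(6) by (simp add: m'_def bl o_def ac_simps)
      show "weight m' = weight ?m"
        unfolding us(4) by (simp add: m'_def bl)
    qed (simp_all add: m'_def)
    moreover define k where "k = length us - 1"
    define a where "a i = us ! (i - 1)" for i
    have "k \<ge> 1" and len_us: "length us = k + 1"
      using len by (auto simp: k_def)
    have "map (\<lambda>i. Uncircled (a i)) [1..<k + 1] = map Uncircled b"
      unfolding a_def len_us [symmetric] map_nth_pred by (simp add: bl)
    moreover have "a (k + 1) = l"
      using bl len_us by (auto simp: a_def nth_append)
    ultimately have Y: "?Y = replicate k0 Circled @ map (\<lambda>i. Uncircled (a i)) [1..<k + 1]
        @ replicate c Circled @ [Uncircled (a (k + 1))] @ replicate k2 Circled"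
      and "circled_composition n ?Y" "wilf_equivalent X ?Y"
      by (simp_all add: m'_def)
    moreover have "\<forall>i\<in>{1..k}. a i \<ge> a (i + 1)"
      using us(1) len_us unfolding a_def sorted_wrt_iff_nth_less by auto
    moreover have "\<forall>i\<in>{1..k + 1}. a i \<noteq> 2"
      using us(2) len_us unfolding a_def by (auto simp: in_set_conv_nth)
    ultimately show ?thesis
      using \<open>k \<ge> 1\<close> \<open>k0 \<ge> 1\<close> \<open>k2 \<ge> 1\<close> \<open>k0 \<ge> k2\<close> \<open>k0 \<noteq> 2\<close> \<open>k2 \<noteq> 2\<close>
      by - (rule exI[of _ ?Y], intro conjI, assumption, assumption, rule disjI2, rule disjI1,
        rule exI[of _ k], rule exI[of _ a], rule exI[of _ k0], rule exI[of _ c],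
        rule exI[of _ k2], blast)
  qed
qed

end
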